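(* Let $(C,\bar\xi)$ be a versor field in a Myller configuration with alternative frame $R_A=\{P(s);\bar\xi_2,\bar Y,\bar D\}$ and (nowhere) non-zero alternative curvatures $p,q$. Then $\bar\xi_2$ satisfies the differential equation $$\bar\xi_2'''-\left[\frac{p'}{p}+\frac{(pq)'}{pq}\right]\bar\xi_2''+\left\{pq\left[\left(\frac1p\right)'\frac1q\right]'+p^2+q^2\right\}\bar\xi_2'+pq\left(\frac pq\right)'\bar\xi_2=0.$$
   Context: All data are smooth. Let $C$ be a curve in Euclidean space $E^3$ with arclength parameter $s\in I$ ($I$ an interval) and position vector $\bar r(s)$, let $\bar\xi(s)$ be a unit vector field along $C$ (a versor field $(C,\bar\xi)$), and let $\pi(s)$ be a plane field along $C$ with $\bar\xi(s)\in\pi(s)$. The pair $((C,\bar\xi),(C,\pi))$ is called a Myller configuration $M=M(C,\bar\xi,\pi)$. Put $\bar\xi_1=\bar\xi$, $K_1=\|d\bar\xi/ds\|>0$ (curvature), define $\bar\xi_2$ by $\bar\xi_1'=K_1\bar\xi_2$, and $\bar\xi_3=\bar\xi_1\times\bar\xi_2$. Then $\{\bar\xi_1,\bar\xi_2,\bar\xi_3\}$ is a positively oriented orthonormal frame, the Frenet-type frame $R_F$, and $$\bar\xi_1'=K_1\bar\xi_2,\quad \bar\xi_2'=-K_1\bar\xi_1+K_2\bar\xi_3,\quad \bar\xi_3'=-K_2\bar\xi_2,$$ which defines the torsion $K_2$. A prime denotes $d/ds$. The alternative frame (AF-frame) is the orthonormal frame $R_A=\{P(s);\bar\xi_2,\bar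 Y,\bar D\}$ with $\bar Y=\bar\xi_2'/\|\bar\xi_2'\|$ and $\bar D=\bar\xi_2\times\bar Y=\frac{K_2}{\sqrt{K_1^2+K_2^2}}\bar\xi_1+\frac{K_1}{\sqrt{K_1^2+K_2^2}}\bar\xi_3$. It satisfies $\bar\xi_2'=p\bar Y$, $\bar Y'=-p\bar\xi_2+q\bar D$, $\bar D'=-q\bar Y$, where the alternative curvatures are $p=\sqrt{K_1^2+K_2^2}$ and $q=\frac{K_1^2}{K_1^2+K_2^2}\left(\frac{K_2}{K_1}\right)'$. *)

theory Defs
  imports "HOL-Analysis.Analysis"
begin

text \<open>
  Derivatives are taken within the parameter interval, hence one-sided at an end point that
  belongs to the interval.
\<close>

definition deriv_on :: "real set \<Rightarrow> (real \<Rightarrow> 'a::real_normed_vector) \<Rightarrow> real \<Rightarrow> 'a" where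
  "deriv_on I f s = vector_derivative f (at s within I)"

definition smooth_along :: "real set \<Rightarrow> (real \<Rightarrow> 'a::real_normed_vector) \<Rightarrow> bool" where
  "smooth_along I f \<longleftrightarrow> (\<forall>n. \<forall>s\<in>I. (deriv_on I ^^ n) f differentiable (at s within I))"

definition versor_field :: "real set \<Rightarrow> (real \<Rightarrow> real ^ 3) \<Rightarrow> bool" where
  "versor_field I \<xi> \<longleftrightarrow> smooth_along I \<xi> \<and> (\<forall>s\<in>I. norm (\<xi> s) = 1)"

text \<open>
  A plane is recorded by its direction space, a set of vectors of \<open>E\<^sup>3\<close>. Smoothness of a plane
  field means that the planes have a unit normal depending smoothly on the parameter.
\<close>

definition plane_field :: "real set \<Rightarrow> (real \<Rightarrow> (real ^ 3) set) \<Rightarrow> bool" where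
  "plane_field I \<pi> \<longleftrightarrow> (\<exists>\<nu>. versor_field I \<nu> \<and> (\<forall>s\<in>I. \<pi> s = {v. \<nu> s \<bullet> v = 0}))"

definition myller_configuration ::
    "real set \<Rightarrow> (real \<Rightarrow> real ^ 3) \<Rightarrow> (real \<Rightarrow> real ^ 3) \<Rightarrow> (real \<Rightarrow> (real ^ 3) set) \<Rightarrow> bool" where
  "myller_configuration I r \<xi> \<pi> \<longleftrightarrow>
     smooth_along I r \<and> (\<forall>s\<in>I. norm (deriv_on I r s) = 1) \<and>
     versor_field I \<xi> \<and> plane_field I \<pi> \<and> (\<forall>s\<in>I. \<xi> s \<in> \<pi> s)"

definition K1 :: "real set \<Rightarrow> (real \<Rightarrow> real ^ 3) \<Rightarrow> real \<Rightarrow> real" where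
  "K1 I \<xi> s = norm (deriv_on I \<xi> s)"

definition xi2 :: "real set \<Rightarrow> (real \<Rightarrow> real ^ 3) \<Rightarrow> real \<Rightarrow> real ^ 3" where
  "xi2 I \<xi> s = deriv_on I \<xi> s /\<^sub>R K1 I \<xi> s"

definition xi3 :: "real set \<Rightarrow> (real \<Rightarrow> real ^ 3) \<Rightarrow> real \<Rightarrow> real ^ 3" where
  "xi3 I \<xi> s = cross3 (\<xi> s) (xi2 I \<xi> s)"

text \<open>
  The torsion is the \<open>xi3\<close>-coefficient in \<open>xi2' = - K1 xi1 + K2 xi3\<close>.
\<close>

definition K2 :: "real set \<Rightarrow> (real \<Rightarrow> real ^ 3) \<Rightarrow> real \<Rightarrow> real" where
  "K2 I \<xi> s = deriv_on I (xi2 I \<xi>) s \<bullet> xi3 I \<xi> s"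

definition alternative_frame ::
    "real set \<Rightarrow> (real \<Rightarrow> real ^ 3) \<Rightarrow> real \<Rightarrow> (real ^ 3) \<times> (real ^ 3) \<times> (real ^ 3)" where
  "alternative_frame I \<xi> s =
     (let Y = deriv_on I (xi2 I \<xi>) s /\<^sub>R norm (deriv_on I (xi2 I \<xi>) s)
      in (xi2 I \<xi> s, Y, cross3 (xi2 I \<xi> s) Y))"

definition alternative_p :: "real set \<Rightarrow> (real \<Rightarrow> real ^ 3) \<Rightarrow> real \<Rightarrow> real" where
  "alternative_p I \<xi> s = sqrt ((K1 I \<xi> s)\<^sup>2 + (K2 I \<xi> s)\<^sup>2)"

definition alternative_q :: "real set \<Rightarrow> (real \<Rightarrow> real ^ 3) \<Rightarrow> real \<Rightarrow> real" where
  "alternative_q I \<xi> s =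
     (K1 I \<xi> s)\<^sup>2 / ((K1 I \<xi> s)\<^sup>2 + (K2 I \<xi> s)\<^sup>2) *
     deriv_on I (\<lambda>t. K2 I \<xi> t / K1 I \<xi> t) s"

end

theory Submission
  imports Defs
begin

text \<open>
  Write \<open>a\<close>, \<open>b\<close> for the curvature and torsion of the versor field, and \<open>p = sqrt (a\<^sup>2 + b\<^sup>2)\<close>.
  The Frenet-type equation \<open>\<xi>\<^sub>2' = b \<xi>\<^sub>3 - a \<xi>\<^sub>1\<close> shows that the alternative frame is obtained from
  the Frenet-type frame by a rotation in the plane orthogonal to \<open>\<xi>\<^sub>2\<close>: if \<open>\<theta>\<close> is the angle with
  \<open>cos \<theta> = a / p\<close> and \<open>sin \<theta> = b / p\<close>, then \<open>Y = sin \<theta> \<xi>\<^sub>3 - cos \<theta> \<xi>\<^sub>1\<close> and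
  \<open>D = sin \<theta> \<xi>\<^sub>1 + cos \<theta> \<xi>\<^sub>3\<close>. Since \<open>tan \<theta> = b / a\<close>, the alternative curvature \<open>q\<close> is exactly \<open>\<theta>'\<close>
  (lemma \<open>cosine_sine_derivatives\<close>, which speaks of the cosine and sine only, so that no angle
  function has to be chosen). Differentiating \<open>Y\<close> and \<open>D\<close> therefore gives the equations
  \<open>\<xi>\<^sub>2' = p Y\<close>, \<open>Y' = q D - p \<xi>\<^sub>2\<close>, \<open>D' = - q Y\<close> (lemma \<open>alternative_frame_derivatives\<close>).

  These three equations have Frenet form, and from them alone \<open>Y\<close> and \<open>D\<close> can be eliminated when
  \<open>p\<close> and \<open>q\<close> do not vanish: the first three derivatives of \<open>\<xi>\<^sub>2\<close> are combinations of \<open>\<xi>\<^sub>2\<close>, \<open>Y\<close>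
  and \<open>D\<close>, and the coefficients of the differential equation are those for which each of the three
  components cancels (lemma \<open>frenet_frame_ode\<close>).

  The elimination differentiates \<open>p\<close> twice and \<open>q\<close> once, so the argument also needs that smoothness
  passes from \<open>\<xi>\<close> to \<open>a\<close>, \<open>b\<close>, \<open>p\<close> and \<open>q\<close>. This follows from closure of smooth functions under
  sums, bilinear products, reciprocals and square roots.
\<close>

section \<open>Expansion in an orthonormal frame of three-space\<close>

text \<open>
  The component of \<open>x\<close> orthogonal to \<open>T\<close> and \<open>N\<close> has vanishing cross product with \<open>T \<times> N\<close>, by the
  double cross product formula, and is therefore its own projection onto \<open>T \<times> N\<close>.
\<close>

lemma orthonormal_cross3_expansion:
  fixes T N x :: "real ^ 3"
  assumes "norm T = 1" "norm N = 1" "T \<bullet> N = 0"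
  shows "x = (x \<bullet> T) *\<^sub>R T + (x \<bullet> N) *\<^sub>R N + (x \<bullet> cross3 T N) *\<^sub>R cross3 T N"
proof -
  define B where "B = cross3 T N"
  define y where "y = x - (x \<bullet> T) *\<^sub>R T - (x \<bullet> N) *\<^sub>R N"
  have unit: "T \<bullet> T = 1" "N \<bullet> N = 1"
    using assms by (simp_all add: dot_square_norm)
  have "(norm B)\<^sup>2 = 1"
    using norm_cross_dot[of T N] assms by (simp add: B_def)
  then have BB: "B \<bullet> B = 1"
    by (simp add: dot_square_norm)
  have yT: "y \<bullet> T = 0" and yN: "y \<bullet> N = 0"
    using unit assms(3) inner_commute[of N T] by (simp_all add: y_def inner_diff_left)
  have yB: "B \<bullet> y = x \<bullet> B"
    using inner_commute[of B x] by (simp add: y_def B_def inner_diff_right dot_cross_self)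
  have "cross3 y B = 0"
    using yT yN by (simp add: B_def Lagrange)
  then have "0 = cross3 B (cross3 y B)"
    by simp
  also have "\<dots> = y - (B \<bullet> y) *\<^sub>R B"
    using BB by (simp add: Lagrange)
  finally have "y = (x \<bullet> B) *\<^sub>R B"
    using yB by simp
  then show ?thesis
    by (simp add: y_def B_def algebra_simps)
qed

section \<open>Calculus of smooth functions on a parameter set\<close>

text \<open>
  Closure of smooth functions under an operation is proved by induction on the order \<open>n\<close>: the
  derivative of a product, reciprocal or square root involves the derivatives of the arguments and
  the arguments or the result itself, all of which are available at the lower order. Order \<open>0\<close>
  demands nothing at all, not even continuity, so every induction has a trivial base case.
\<close>

definition differentiable_upto :: "nat \<Rightarrow> real set \<Rightarrow> (real \<Rightarrow> 'a::real_normed_vector) \<Rightarrow> bool" where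
  "differentiable_upto n I f \<longleftrightarrow>
     (\<forall>k<n. \<forall>s\<in>I. (deriv_on I ^^ k) f differentiable (at s within I))"

lemma smooth_along_iff_differentiable_upto: "smooth_along I f \<longleftrightarrow> (\<forall>n. differentiable_upto n I f)"
  by (auto simp: smooth_along_def differentiable_upto_def)

lemma differentiable_upto_0 [simp]: "differentiable_upto 0 I f"
  by (simp add: differentiable_upto_def)

lemma differentiable_upto_mono: "differentiable_upto n I f \<Longrightarrow> m \<le> n \<Longrightarrow> differentiable_upto m I f"
  by (auto simp: differentiable_upto_def)

lemma differentiable_upto_Suc:
  "differentiable_upto (Suc n) I f \<longleftrightarrow>
     (\<forall>s\<in>I. f differentiable (at s within I)) \<and> differentiable_upto n I (deriv_on I f)"
  unfolding differentiable_upto_def by (auto simp: funpow_swap1 less_Suc_eq_0_disj)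

lemma differentiable_has_deriv_on:
  "f differentiable (at s within I) \<Longrightarrow> (f has_vector_derivative deriv_on I f s) (at s within I)"
  by (simp add: deriv_on_def vector_derivative_works)

lemma differentiable_upto_has_deriv_on:
  "differentiable_upto (Suc n) I f \<Longrightarrow> s \<in> I \<Longrightarrow>
    (f has_vector_derivative deriv_on I f s) (at s within I)"
  by (rule differentiable_has_deriv_on) (simp add: differentiable_upto_Suc)

text \<open>
  On a set of limit points the derivative within the set is unique, so that \<open>deriv_on\<close> can be
  computed by exhibiting a derivative; it then depends only on the values on the set.
\<close>

locale parameter_domain =
  fixes I :: "real set"
  assumes perfect: "s \<in> I \<Longrightarrow> at s within I \<noteq> bot"
begin

lemma deriv_on_eqI:
  "s \<in> I \<Longrightarrow> (f has_vector_derivative f') (at s within I) \<Longrightarrow> deriv_on I f s = f'"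
  unfolding deriv_on_def by (rule vector_derivative_within[OF perfect])

lemma deriv_on_eqI_cong:
  assumes "s \<in> I" "\<And>t. t \<in> I \<Longrightarrow> g t = f t" "(f has_vector_derivative f') (at s within I)"
  shows "deriv_on I g s = f'"
  using assms by (intro deriv_on_eqI has_vector_derivative_transform[of s I g f])

text \<open>
  This is the step used in all closure proofs: any \<open>f'\<close> that is pointwise a derivative of \<open>f\<close> on \<open>I\<close>
  may take the place of \<open>deriv_on I f\<close>, although the two can differ outside \<open>I\<close>.
\<close>

lemma differentiable_upto_SucI:
  assumes "\<And>s. s \<in> I \<Longrightarrow> (f has_vector_derivative f' s) (at s within I)"
    and "differentiable_upto n I f'"
  shows "differentiable_upto (Suc n) I f"
  using assms
proof (induction n arbitrary: f f')
  case 0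
  then show ?case
    by (auto simp: differentiable_upto_def intro: differentiableI_vector)
next
  case (Suc n)
  have "(deriv_on I f has_vector_derivative deriv_on I f' s) (at s within I)" if "s \<in> I" for s
  proof (rule has_vector_derivative_transform[OF that])
    show "deriv_on I f t = f' t" if "t \<in> I" for t
      by (rule deriv_on_eqI[OF that Suc.prems(1)[OF that]])
    show "(f' has_vector_derivative deriv_on I f' s) (at s within I)"
      by (rule differentiable_upto_has_deriv_on[OF Suc.prems(2) that])
  qed
  then have "differentiable_upto (Suc n) I (deriv_on I f)"
    using Suc.prems(2) by (intro Suc.IH) (auto simp: differentiable_upto_Suc)
  then show ?case
    using Suc.prems(1) by (subst differentiable_upto_Suc) (auto intro: differentiableI_vector)
qed

lemma differentiable_upto_cong:
  assumes "differentiable_upto n I f" "\<And>s. s \<in> I \<Longrightarrow> g s = f s"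
  shows "differentiable_upto n I g"
proof (cases n)
  case (Suc m)
  have "(g has_vector_derivative deriv_on I f s) (at s within I)" if "s \<in> I" for s
    by (rule has_vector_derivative_transform[where f = f, OF that assms(2)
          differentiable_upto_has_deriv_on[OF assms(1)[unfolded Suc] that]])
  moreover have "differentiable_upto m I (deriv_on I f)"
    using assms(1) by (simp add: Suc differentiable_upto_Suc)
  ultimately show ?thesis
    unfolding Suc by (rule differentiable_upto_SucI)
qed simp

lemma differentiable_upto_add:
  "differentiable_upto n I f \<Longrightarrow> differentiable_upto n I g \<Longrightarrow> differentiable_upto n I (\<lambda>s. f s + g s)"
proof (induction n arbitrary: f g)
  case (Suc n)
  show ?case
    using Suc.prems
    by (intro differentiable_upto_SucI[where f' = "\<lambda>s. deriv_on I f s + deriv_on I g s"] Suc.IH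
        has_vector_derivative_add differentiable_has_deriv_on) (auto simp: differentiable_upto_Suc)
qed simp

lemma differentiable_upto_uminus:
  "differentiable_upto n I f \<Longrightarrow> differentiable_upto n I (\<lambda>s. - f s)"
proof (induction n arbitrary: f)
  case (Suc n)
  show ?case
    using Suc.prems
    by (intro differentiable_upto_SucI[where f' = "\<lambda>s. - deriv_on I f s"] Suc.IH
        has_vector_derivative_minus differentiable_has_deriv_on) (auto simp: differentiable_upto_Suc)
qed simp

lemma differentiable_upto_bilinear:
  assumes "bounded_bilinear b"
  shows "differentiable_upto n I f \<Longrightarrow> differentiable_upto n I g \<Longrightarrow>
    differentiable_upto n I (\<lambda>s. b (f s) (g s))"
proof (induction n arbitrary: f g)
  case (Suc n)
  have low: "differentiable_upto n I f" "differentiable_upto n I g"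
    using Suc.prems by (auto intro: differentiable_upto_mono)
  show ?case
    using Suc.prems low
    by (intro differentiable_upto_SucI[where
          f' = "\<lambda>s. b (f s) (deriv_on I g s) + b (deriv_on I f s) (g s)"]
        Suc.IH differentiable_upto_add
        bounded_bilinear.has_vector_derivative[OF assms] differentiable_has_deriv_on)
      (auto simp: differentiable_upto_Suc)
qed simp

lemma differentiable_upto_inverse:
  fixes f :: "real \<Rightarrow> real"
  assumes "\<And>s. s \<in> I \<Longrightarrow> f s \<noteq> 0"
  shows "differentiable_upto n I f \<Longrightarrow> differentiable_upto n I (\<lambda>s. inverse (f s))"
proof (induction n)
  case (Suc n)
  have inv: "differentiable_upto n I (\<lambda>s. inverse (f s))"
    using Suc.IH differentiable_upto_mono[OF Suc.prems, of n] by simp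
  have "((\<lambda>s. inverse (f s)) has_vector_derivative
      - (inverse (f s) * (deriv_on I f s * inverse (f s)))) (at s within I)" if "s \<in> I" for s
  proof -
    have "(f has_real_derivative deriv_on I f s) (at s within I)"
      using Suc.prems that
      by (auto simp: has_real_derivative_iff_has_vector_derivative differentiable_upto_Suc
          intro: differentiable_has_deriv_on)
    from DERIV_inverse'[OF this assms[OF that]] show ?thesis
      by (simp add: has_real_derivative_iff_has_vector_derivative mult.assoc)
  qed
  then show ?case
    using Suc.prems inv
    by (intro differentiable_upto_SucI[where
          f' = "\<lambda>s. - (inverse (f s) * (deriv_on I f s * inverse (f s)))"]
        differentiable_upto_uminus differentiable_upto_bilinear[OF bounded_bilinear_mult])
      (auto simp: differentiable_upto_Suc)
qed simp

lemma differentiable_upto_sqrt: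
  fixes f :: "real \<Rightarrow> real"
  assumes "\<And>s. s \<in> I \<Longrightarrow> f s > 0"
  shows "differentiable_upto n I f \<Longrightarrow> differentiable_upto n I (\<lambda>s. sqrt (f s))"
proof (induction n)
  case (Suc n)
  have "differentiable_upto n I (\<lambda>s. sqrt (f s))"
    using Suc.IH differentiable_upto_mono[OF Suc.prems, of n] by simp
  then have inv: "differentiable_upto n I (\<lambda>s. inverse (sqrt (f s) + sqrt (f s)))"
    using assms by (intro differentiable_upto_inverse differentiable_upto_add)
      (auto simp: less_imp_neq[symmetric])
  have "((\<lambda>s. sqrt (f s)) has_vector_derivative
      deriv_on I f s * inverse (sqrt (f s) + sqrt (f s))) (at s within I)" if "s \<in> I" for s
  proof -
    have "(f has_real_derivative deriv_on I f s) (at s within I)"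
      using Suc.prems that
      by (auto simp: has_real_derivative_iff_has_vector_derivative differentiable_upto_Suc
          intro: differentiable_has_deriv_on)
    from DERIV_chain2[OF DERIV_real_sqrt[OF assms[OF that]] this] show ?thesis
      by (simp add: has_real_derivative_iff_has_vector_derivative field_simps)
  qed
  then show ?case
    using Suc.prems inv
    by (intro differentiable_upto_SucI[where
          f' = "\<lambda>s. deriv_on I f s * inverse (sqrt (f s) + sqrt (f s))"]
        differentiable_upto_bilinear[OF bounded_bilinear_mult])
      (auto simp: differentiable_upto_Suc)
qed simp

lemma smooth_has_deriv_on:
  "smooth_along I f \<Longrightarrow> s \<in> I \<Longrightarrow> (f has_vector_derivative deriv_on I f s) (at s within I)"
  by (rule differentiable_has_deriv_on) (auto simp: smooth_along_def dest: spec[of _ 0])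

lemma smooth_has_real_derivative:
  fixes f :: "real \<Rightarrow> real"
  shows "smooth_along I f \<Longrightarrow> s \<in> I \<Longrightarrow> (f has_real_derivative deriv_on I f s) (at s within I)"
  by (simp add: has_real_derivative_iff_has_vector_derivative smooth_has_deriv_on)

lemma smooth_deriv_on: "smooth_along I f \<Longrightarrow> smooth_along I (deriv_on I f)"
  using differentiable_upto_Suc[of _ I f] by (auto simp: smooth_along_iff_differentiable_upto)

lemma smooth_cong:
  assumes "smooth_along I f" "\<And>s. s \<in> I \<Longrightarrow> g s = f s"
  shows "smooth_along I g"
  using assms differentiable_upto_cong[of _ f g] by (auto simp: smooth_along_iff_differentiable_upto)

lemma smooth_add: "smooth_along I f \<Longrightarrow> smooth_along I g \<Longrightarrow> smooth_along I (\<lambda>s. f s + g s)"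
  by (simp add: smooth_along_iff_differentiable_upto differentiable_upto_add)

lemma smooth_bilinear:
  "bounded_bilinear b \<Longrightarrow> smooth_along I f \<Longrightarrow> smooth_along I g \<Longrightarrow> smooth_along I (\<lambda>s. b (f s) (g s))"
  by (simp add: smooth_along_iff_differentiable_upto differentiable_upto_bilinear)

lemmas smooth_mult = smooth_bilinear[OF bounded_bilinear_mult]
lemmas smooth_scaleR = smooth_bilinear[OF bounded_bilinear_scaleR]
lemmas smooth_inner = smooth_bilinear[OF bounded_bilinear_inner]
lemmas smooth_cross3 =
  smooth_bilinear[OF bilinear_cross[unfolded bilinear_conv_bounded_bilinear]]

lemma smooth_inverse:
  fixes f :: "real \<Rightarrow> real"
  shows "smooth_along I f \<Longrightarrow> (\<And>s. s \<in> I \<Longrightarrow> f s \<noteq> 0) \<Longrightarrow> smooth_along I (\<lambda>s. inverse (f s))"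
  by (simp add: smooth_along_iff_differentiable_upto differentiable_upto_inverse)

lemma smooth_divide:
  fixes f :: "real \<Rightarrow> real"
  shows "smooth_along I f \<Longrightarrow> smooth_along I g \<Longrightarrow> (\<And>s. s \<in> I \<Longrightarrow> g s \<noteq> 0) \<Longrightarrow>
    smooth_along I (\<lambda>s. f s / g s)"
  unfolding divide_inverse by (intro smooth_mult smooth_inverse)

lemma smooth_sqrt:
  fixes f :: "real \<Rightarrow> real"
  shows "smooth_along I f \<Longrightarrow> (\<And>s. s \<in> I \<Longrightarrow> f s > 0) \<Longrightarrow> smooth_along I (\<lambda>s. sqrt (f s))"
  by (simp add: smooth_along_iff_differentiable_upto differentiable_upto_sqrt)

text \<open>
  Applied to the relations \<open>T \<bullet> T = 1\<close>, \<open>N \<bullet> N = 1\<close>, \<open>T \<bullet> N = 0\<close> of an orthonormal frame, this makes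
  the coefficients of the frame derivatives skew-symmetric.
\<close>

lemma deriv_inner_const:
  assumes "s \<in> I" "\<And>t. t \<in> I \<Longrightarrow> f t \<bullet> g t = c"
    and "(f has_vector_derivative f') (at s within I)" "(g has_vector_derivative g') (at s within I)"
  shows "f' \<bullet> g s = - (f s \<bullet> g')"
proof -
  have "((\<lambda>t. f t \<bullet> g t) has_vector_derivative f s \<bullet> g' + f' \<bullet> g s) (at s within I)"
    by (rule bounded_bilinear.has_vector_derivative[OF bounded_bilinear_inner assms(3,4)])
  moreover have "deriv_on I (\<lambda>t. f t \<bullet> g t) s = 0"
    using assms(1,2) by (intro deriv_on_eqI_cong[where f = "\<lambda>_. c"]) auto
  ultimately show ?thesis
    using deriv_on_eqI[OF assms(1)] by fastforce
qed

section \<open>The third-order equation of a Frenet system\<close>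

text \<open>
  Only the Frenet form of the system is used, hence the frame may live in any normed space. From
  \<open>N'' = p' Y - p\<^sup>2 N + p q D\<close> and
  \<open>N''' = (p'' - p\<^sup>3 - p q\<^sup>2) Y - 3 p p' N + (2 p' q + p q') D\<close> one sees that \<open>D\<close> is removed by
  subtracting \<open>p' / p + (p q)' / (p q)\<close> times \<open>N''\<close> from \<open>N'''\<close>. What remains in the \<open>Y\<close>
  direction is a multiple of \<open>N' = p Y\<close>, and the rest is a multiple of \<open>N\<close>.
\<close>

lemma frenet_frame_ode:
  fixes N Y D :: "real \<Rightarrow> 'a::real_normed_vector" and p q :: "real \<Rightarrow> real"
  assumes N: "\<And>s. s \<in> I \<Longrightarrow> (N has_vector_derivative p s *\<^sub>R Y s) (at s within I)"
    and Y: "\<And>s. s \<in> I \<Longrightarrow> (Y has_vector_derivative q s *\<^sub>R D s - p s *\<^sub>R N s) (at s within I)"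
    and D: "\<And>s. s \<in> I \<Longrightarrow> (D has_vector_derivative - q s *\<^sub>R Y s) (at s within I)"
    and p: "smooth_along I p" "\<And>s. s \<in> I \<Longrightarrow> p s \<noteq> 0"
    and q: "smooth_along I q" "\<And>s. s \<in> I \<Longrightarrow> q s \<noteq> 0"
    and s: "s \<in> I"
  shows "(deriv_on I ^^ 3) N s
    - (deriv_on I p s / p s + deriv_on I (\<lambda>t. p t * q t) s / (p s * q s))
        *\<^sub>R (deriv_on I ^^ 2) N s
    + (p s * q s * deriv_on I (\<lambda>t. deriv_on I (\<lambda>u. 1 / p u) t * (1 / q t)) s
         + (p s)\<^sup>2 + (q s)\<^sup>2) *\<^sub>R deriv_on I N s
    + (p s * q s * deriv_on I (\<lambda>t. p t / q t) s) *\<^sub>R N s = 0"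
proof -
  note p0 = p(2) and q0 = q(2)
  define p' where "p' = deriv_on I p"
  define p'' where "p'' = deriv_on I p'"
  define q' where "q' = deriv_on I q"
  have dp: "(p has_real_derivative p' s) (at s within I)" if "s \<in> I" for s
    using smooth_has_real_derivative[OF p(1) that] by (simp add: p'_def)
  have dp': "(p' has_real_derivative p'' s) (at s within I)" if "s \<in> I" for s
    using smooth_has_real_derivative[OF smooth_deriv_on[OF p(1)] that]
    by (simp add: p'_def p''_def)
  have dq: "(q has_real_derivative q' s) (at s within I)" if "s \<in> I" for s
    using smooth_has_real_derivative[OF q(1) that] by (simp add: q'_def)
  note real_to_vector = has_real_derivative_iff_has_vector_derivative[THEN iffD1]

  have N1: "deriv_on I N t = p t *\<^sub>R Y t" if "t \<in> I" for t
    using that by (intro deriv_on_eqI N)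
  have N2: "deriv_on I (deriv_on I N) t
      = p' t *\<^sub>R Y t - (p t * p t) *\<^sub>R N t + (p t * q t) *\<^sub>R D t" if "t \<in> I" for t
  proof (rule deriv_on_eqI_cong[OF that N1])
    show "((\<lambda>t. p t *\<^sub>R Y t) has_vector_derivative
        p' t *\<^sub>R Y t - (p t * p t) *\<^sub>R N t + (p t * q t) *\<^sub>R D t) (at t within I)"
      using has_vector_derivative_scaleR[OF dp[OF that] Y[OF that]] by (simp add: algebra_simps)
  qed
  \<comment> \<open>Repeated terms are kept as sums, without numerals, so that both sides of the expansion below
    have the same normal form.\<close>
  have N3: "deriv_on I (deriv_on I (deriv_on I N)) s
      = (p'' s - p s ^ 3 - p s * (q s)\<^sup>2) *\<^sub>R Y s - (p' s * p s + p' s * p s + p' s * p s) *\<^sub>R N s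
        + (p' s * q s + p' s * q s + p s * q' s) *\<^sub>R D s"
  proof (rule deriv_on_eqI_cong[OF s N2])
    have "((\<lambda>t. p' t *\<^sub>R Y t - (p t * p t) *\<^sub>R N t + (p t * q t) *\<^sub>R D t) has_vector_derivative
        (p' s *\<^sub>R (q s *\<^sub>R D s - p s *\<^sub>R N s) + p'' s *\<^sub>R Y s)
        - ((p s * p s) *\<^sub>R (p s *\<^sub>R Y s) + (p' s * p s + p' s * p s) *\<^sub>R N s)
        + ((p s * q s) *\<^sub>R (- q s *\<^sub>R Y s) + (p' s * q s + q' s * p s) *\<^sub>R D s)) (at s within I)"
      using s by (intro has_vector_derivative_add has_vector_derivative_diff
          has_vector_derivative_scaleR DERIV_mult dp dp' dq N Y D)
    also have "(p' s *\<^sub>R (q s *\<^sub>R D s - p s *\<^sub>R N s) + p'' s *\<^sub>R Y s)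
        - ((p s * p s) *\<^sub>R (p s *\<^sub>R Y s) + (p' s * p s + p' s * p s) *\<^sub>R N s)
        + ((p s * q s) *\<^sub>R (- q s *\<^sub>R Y s) + (p' s * q s + q' s * p s) *\<^sub>R D s)
        = (p'' s - p s ^ 3 - p s * (q s)\<^sup>2) *\<^sub>R Y s - (p' s * p s + p' s * p s + p' s * p s) *\<^sub>R N s
        + (p' s * q s + p' s * q s + p s * q' s) *\<^sub>R D s"
      by (simp only: scaleR_add_left scaleR_diff_left scaleR_add_right scaleR_diff_right
          scaleR_scaleR scaleR_minus_left scaleR_minus_right mult_minus_right power2_eq_square power3_eq_cube
          diff_conv_add_uminus minus_add_distrib minus_minus mult_ac add_ac)
    finally show "((\<lambda>t. p' t *\<^sub>R Y t - (p t * p t) *\<^sub>R N t + (p t * q t) *\<^sub>R D t)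
      has_vector_derivative (p'' s - p s ^ 3 - p s * (q s)\<^sup>2) *\<^sub>R Y s - (p' s * p s + p' s * p s + p' s * p s) *\<^sub>R N s
        + (p' s * q s + p' s * q s + p s * q' s) *\<^sub>R D s) (at s within I)" .
  qed

  have dpq: "deriv_on I (\<lambda>t. p t * q t) s = p' s * q s + p s * q' s"
    using DERIV_mult[OF dp[OF s] dq[OF s]]
    by (intro deriv_on_eqI[OF s] real_to_vector) (simp add: mult.commute)
  have dpdq: "deriv_on I (\<lambda>t. p t / q t) s = (p' s * q s - p s * q' s) / (q s * q s)"
    using DERIV_divide[OF dp[OF s] dq[OF s] q0[OF s]]
    by (intro deriv_on_eqI[OF s] real_to_vector)
  have dip: "deriv_on I (\<lambda>u. 1 / p u) t = - p' t / (p t * p t)" if "t \<in> I" for t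
    using DERIV_divide[OF DERIV_const[of 1] dp[OF that] p0[OF that]]
    by (intro deriv_on_eqI[OF that] real_to_vector) simp
  have dipq: "deriv_on I (\<lambda>t. deriv_on I (\<lambda>u. 1 / p u) t * (1 / q t)) s
      = (- p'' s * (p s * p s * q s) + p' s * (2 * p s * p' s * q s + p s * p s * q' s))
        / (p s * p s * q s)\<^sup>2"
  proof (rule deriv_on_eqI_cong[OF s])
    show "deriv_on I (\<lambda>u. 1 / p u) t * (1 / q t) = - p' t / (p t * p t * q t)" if "t \<in> I" for t
      using dip[OF that] by simp
    have "((\<lambda>t. - p' t / (p t * p t * q t)) has_real_derivative
        (- p'' s * (p s * p s * q s) - - p' s * ((p' s * p s + p' s * p s) * q s + q' s * (p s * p s)))
        / ((p s * p s * q s) * (p s * p s * q s))) (at s within I)"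
      using s p0[OF s] q0[OF s] by (intro DERIV_divide DERIV_minus DERIV_mult dp dp' dq) auto
    then show "((\<lambda>t. - p' t / (p t * p t * q t)) has_vector_derivative
        (- p'' s * (p s * p s * q s) + p' s * (2 * p s * p' s * q s + p s * p s * q' s))
        / (p s * p s * q s)\<^sup>2) (at s within I)"
      by (intro real_to_vector) (simp add: power2_eq_square algebra_simps)
  qed

  define A where "A = p' s / p s + (p' s * q s + p s * q' s) / (p s * q s)"
  define E where "E = (- p'' s * (p s * p s * q s)
      + p' s * (2 * p s * p' s * q s + p s * p s * q' s)) / (p s * p s * q s)\<^sup>2"
  define F where "F = (p' s * q s - p s * q' s) / (q s * q s)"
  \<comment> \<open>The components of the equation along \<open>D\<close>, \<open>N\<close> and \<open>Y\<close>.\<close>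
  have cD: "p' s * q s + p' s * q s + p s * q' s - A * (p s * q s) = 0"
    using p0[OF s] q0[OF s] by (simp add: A_def field_simps)
  have cN: "- (p' s * p s + p' s * p s + p' s * p s) + A * (p s * p s) + p s * q s * F = 0"
    using p0[OF s] q0[OF s] by (simp add: A_def F_def field_simps)
  have cY: "p'' s - p s ^ 3 - p s * (q s)\<^sup>2 - A * p' s
      + (p s * q s * E + (p s)\<^sup>2 + (q s)\<^sup>2) * p s = 0"
    using p0[OF s] q0[OF s] by (simp add: A_def E_def field_simps power2_eq_square power3_eq_cube)
  have "(deriv_on I ^^ 3) N s - A *\<^sub>R (deriv_on I ^^ 2) N s
      + (p s * q s * E + (p s)\<^sup>2 + (q s)\<^sup>2) *\<^sub>R deriv_on I N s + (p s * q s * F) *\<^sub>R N s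
    = (p'' s - p s ^ 3 - p s * (q s)\<^sup>2 - A * p' s
        + (p s * q s * E + (p s)\<^sup>2 + (q s)\<^sup>2) * p s) *\<^sub>R Y s
      + (- (p' s * p s + p' s * p s + p' s * p s) + A * (p s * p s) + p s * q s * F) *\<^sub>R N s
      + (p' s * q s + p' s * q s + p s * q' s - A * (p s * q s)) *\<^sub>R D s"
    using N1[OF s] N2[OF s] N3
    by (simp add: numeral_2_eq_2 numeral_3_eq_3 scaleR_add_left scaleR_diff_left
        scaleR_add_right scaleR_diff_right)
  also have "\<dots> = 0"
    unfolding cD cN cY by simp
  finally show ?thesis
    unfolding dpq dpdq dipq A_def E_def F_def p'_def[symmetric] .
qed

end

section \<open>The alternative frame as a rotated Frenet-type frame\<close>

locale regular_versor_field = parameter_domain +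
  fixes \<xi> :: "real \<Rightarrow> real ^ 3"
  assumes versor: "versor_field I \<xi>"
    and K1_pos: "s \<in> I \<Longrightarrow> K1 I \<xi> s > 0"
begin

abbreviation "N \<equiv> xi2 I \<xi>"
abbreviation "B \<equiv> xi3 I \<xi>"
abbreviation "a \<equiv> K1 I \<xi>"
abbreviation "b \<equiv> K2 I \<xi>"
abbreviation "p \<equiv> alternative_p I \<xi>"
abbreviation "q \<equiv> alternative_q I \<xi>"

lemma smooth_xi: "smooth_along I \<xi>"
  using versor by (simp add: versor_field_def)

lemma smooth_K1: "smooth_along I a"
proof -
  have "smooth_along I (\<lambda>s. sqrt (deriv_on I \<xi> s \<bullet> deriv_on I \<xi> s))"
    using K1_pos by (intro smooth_sqrt smooth_inner smooth_deriv_on smooth_xi) (auto simp: K1_def)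
  then show ?thesis
    by (rule smooth_cong) (simp add: K1_def norm_eq_sqrt_inner)
qed

lemma smooth_xi2: "smooth_along I N"
  unfolding xi2_def[abs_def] using K1_pos
  by (intro smooth_scaleR smooth_inverse smooth_deriv_on smooth_xi smooth_K1)
    (auto simp: less_imp_neq[symmetric])

lemma smooth_xi3: "smooth_along I B"
  unfolding xi3_def[abs_def] by (intro smooth_cross3 smooth_xi smooth_xi2)

lemma smooth_K2: "smooth_along I b"
  unfolding K2_def[abs_def] by (intro smooth_inner smooth_deriv_on smooth_xi2 smooth_xi3)

lemma sum_squares_pos: "s \<in> I \<Longrightarrow> (a s)\<^sup>2 + (b s)\<^sup>2 > 0"
  using K1_pos[of s] by (simp add: add_pos_nonneg)

lemma p_pos: "s \<in> I \<Longrightarrow> p s > 0"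
  using sum_squares_pos[of s] by (simp add: alternative_p_def)

lemma p_square: "(p s)\<^sup>2 = (a s)\<^sup>2 + (b s)\<^sup>2"
  by (simp add: alternative_p_def)

lemma smooth_sum_squares: "smooth_along I (\<lambda>s. (a s)\<^sup>2 + (b s)\<^sup>2)"
  unfolding power2_eq_square by (intro smooth_add smooth_mult smooth_K1 smooth_K2)

lemma smooth_p: "smooth_along I p"
  unfolding alternative_p_def[abs_def]
  by (intro smooth_sqrt smooth_sum_squares sum_squares_pos)

lemma smooth_q: "smooth_along I q"
proof -
  have "smooth_along I (\<lambda>s. (a s * a s) / ((a s)\<^sup>2 + (b s)\<^sup>2) * deriv_on I (\<lambda>t. b t / a t) s)"
    by (intro smooth_mult smooth_divide smooth_deriv_on smooth_sum_squares smooth_K1 smooth_K2)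
      (use K1_pos sum_squares_pos in \<open>force+\<close>)
  then show ?thesis
    by (rule smooth_cong) (simp add: alternative_q_def power2_eq_square)
qed

lemma xi_derivative:
  assumes "s \<in> I"
  shows "(\<xi> has_vector_derivative a s *\<^sub>R N s) (at s within I)"
  using smooth_has_deriv_on[OF smooth_xi assms] K1_pos[OF assms] by (simp add: xi2_def)

lemma xi_unit: "s \<in> I \<Longrightarrow> norm (\<xi> s) = 1"
  using versor by (simp add: versor_field_def)

lemma xi2_unit: "s \<in> I \<Longrightarrow> norm (N s) = 1"
  using K1_pos[of s] by (simp add: xi2_def K1_def)

lemma xi_inner_xi2:
  assumes "s \<in> I"
  shows "\<xi> s \<bullet> N s = 0"
proof -
  have "\<xi> t \<bullet> \<xi> t = 1" if "t \<in> I" for t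
    using xi_unit[OF that] by (simp add: dot_square_norm)
  from deriv_inner_const[OF assms this xi_derivative xi_derivative, OF _ assms assms]
  show ?thesis
    using K1_pos[OF assms] by (simp add: inner_commute)
qed

text \<open>
  The torsion is by definition the \<open>\<xi>\<^sub>3\<close>-component of \<open>\<xi>\<^sub>2'\<close>; the other two components are forced by
  orthonormality.
\<close>

lemma xi2_derivative:
  assumes "s \<in> I"
  shows "(N has_vector_derivative b s *\<^sub>R B s - a s *\<^sub>R \<xi> s) (at s within I)"
proof -
  note dN = smooth_has_deriv_on[OF smooth_xi2 assms]
  have unit: "N t \<bullet> N t = 1" if "t \<in> I" for t
    using xi2_unit[OF that] by (simp add: dot_square_norm)
  have "deriv_on I N s \<bullet> N s = 0"
    using deriv_inner_const[OF assms unit dN dN] by (simp add: inner_commute)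
  moreover have "deriv_on I N s \<bullet> \<xi> s = - a s"
    using deriv_inner_const[OF assms xi_inner_xi2 xi_derivative[OF assms] dN] unit[OF assms]
    by (simp add: inner_commute)
  ultimately have "deriv_on I N s = b s *\<^sub>R B s - a s *\<^sub>R \<xi> s"
    using orthonormal_cross3_expansion[
        OF xi_unit[OF assms] xi2_unit[OF assms] xi_inner_xi2[OF assms], of "deriv_on I N s"]
    by (simp add: K2_def xi3_def)
  with dN show ?thesis by simp
qed

lemma cross_xi2_xi: "cross3 (N s) (\<xi> s) = - B s"
  by (simp add: xi3_def cross_skew[of "N s"])

lemma cross_xi2_xi3: "s \<in> I \<Longrightarrow> cross3 (N s) (B s) = \<xi> s"
  using xi2_unit[of s] xi_inner_xi2[of s]
  by (simp add: xi3_def Lagrange dot_square_norm inner_commute)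

lemma xi3_derivative:
  assumes "s \<in> I"
  shows "(B has_vector_derivative - b s *\<^sub>R N s) (at s within I)"
proof -
  have "cross3 (\<xi> s) (B s) = - N s"
    using xi_unit[OF assms] xi_inner_xi2[OF assms]
    by (simp add: xi3_def Lagrange dot_square_norm inner_commute)
  then have "cross3 (\<xi> s) (b s *\<^sub>R B s - a s *\<^sub>R \<xi> s) + cross3 (a s *\<^sub>R N s) (N s) = - b s *\<^sub>R N s"
    by (simp add: Cross3.right_diff_distrib cross_mult_left cross_mult_right)
  with bounded_bilinear.has_vector_derivative[
      OF bilinear_cross[unfolded bilinear_conv_bounded_bilinear]
        xi_derivative[OF assms] xi2_derivative[OF assms]]
  show ?thesis
    unfolding xi3_def[abs_def] by simp
qed

lemma norm_xi2_derivative: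
  assumes "s \<in> I"
  shows "norm (b s *\<^sub>R B s - a s *\<^sub>R \<xi> s) = p s"
proof -
  have "B s \<bullet> B s = 1"
    using norm_cross_dot[of "\<xi> s" "N s"] xi_unit[OF assms] xi2_unit[OF assms] xi_inner_xi2[OF assms]
    by (simp add: xi3_def power2_norm_eq_inner)
  moreover have "B s \<bullet> \<xi> s = 0" "\<xi> s \<bullet> B s = 0"
    by (simp_all add: xi3_def dot_cross_self)
  moreover have "\<xi> s \<bullet> \<xi> s = 1"
    using xi_unit[OF assms] by (simp add: dot_square_norm)
  ultimately have "(norm (b s *\<^sub>R B s - a s *\<^sub>R \<xi> s))\<^sup>2 = (a s)\<^sup>2 + (b s)\<^sup>2"
    unfolding power2_norm_eq_inner
    by (simp add: inner_diff_left inner_diff_right power2_eq_square)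
  then show ?thesis
    by (metis alternative_p_def norm_ge_zero real_sqrt_unique)
qed

lemma alternative_frame_eq:
  assumes "s \<in> I"
  shows "alternative_frame I \<xi> s =
    (N s, (b s / p s) *\<^sub>R B s - (a s / p s) *\<^sub>R \<xi> s, (b s / p s) *\<^sub>R \<xi> s + (a s / p s) *\<^sub>R B s)"
  using deriv_on_eqI[OF assms xi2_derivative[OF assms]] norm_xi2_derivative[OF assms]
    cross_xi2_xi[of s] cross_xi2_xi3[OF assms]
  by (simp add: alternative_frame_def Let_def Cross3.right_diff_distrib cross_mult_right
      scaleR_diff_right divide_inverse mult.commute)

text \<open>
  With \<open>a = p cos \<theta>\<close> and \<open>b = p sin \<theta>\<close> this says \<open>\<theta>' = q\<close>. Indeed \<open>p\<^sup>2 = a\<^sup>2 + b\<^sup>2\<close> gives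
  \<open>p p' = a a' + b b'\<close>, the definition of \<open>q\<close> amounts to \<open>q p\<^sup>2 = a b' - b a'\<close>, and the two together
  determine the derivatives of \<open>a / p\<close> and \<open>b / p\<close>.
\<close>

lemma cosine_sine_derivatives:
  assumes s: "s \<in> I"
  shows "((\<lambda>t. a t / p t) has_real_derivative - (q s * (b s / p s))) (at s within I)" (is ?cos)
    and "((\<lambda>t. b t / p t) has_real_derivative q s * (a s / p s)) (at s within I)" (is ?sin)
proof -
  define a' where "a' = deriv_on I a s"
  define b' where "b' = deriv_on I b s"
  have p0: "p s \<noteq> 0" and a0: "a s \<noteq> 0"
    using p_pos[OF s] K1_pos[OF s] by auto
  have da: "(a has_real_derivative a') (at s within I)"
    and db: "(b has_real_derivative b') (at s within I)"
    using smooth_has_real_derivative smooth_K1 smooth_K2 s by (auto simp: a'_def b'_def)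
  define P where "P = deriv_on I p s"
  have dp: "(p has_real_derivative P) (at s within I)"
    using smooth_has_real_derivative[OF smooth_p s] by (simp add: P_def)
  have "((\<lambda>t. (p t)\<^sup>2) has_real_derivative 2 * (P * p s)) (at s within I)"
    using DERIV_power[OF dp, of 2] by (simp add: mult.commute mult.left_commute)
  moreover have "((\<lambda>t. (p t)\<^sup>2) has_real_derivative 2 * (a' * a s + b' * b s)) (at s within I)"
    unfolding p_square using DERIV_add[OF DERIV_power[OF da, of 2] DERIV_power[OF db, of 2]]
    by (simp add: algebra_simps)
  ultimately have "2 * (P * p s) = 2 * (a' * a s + b' * b s)"
    by (metis deriv_on_eqI[OF s] has_real_derivative_iff_has_vector_derivative)
  then have P: "P * p s = a' * a s + b' * b s"
    by simp
  have "deriv_on I (\<lambda>t. b t / a t) s = (b' * a s - b s * a') / (a s * a s)"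
    using DERIV_divide[OF db da a0]
    by (intro deriv_on_eqI[OF s]) (simp add: has_real_derivative_iff_has_vector_derivative)
  then have q: "q s * (p s)\<^sup>2 = b' * a s - b s * a'"
    using a0 p0 by (simp add: alternative_q_def flip: p_square) (simp add: power2_eq_square)
  have "(a' * p s - a s * P) * (p s)\<^sup>2 = (a' * (p s)\<^sup>2 - a s * (P * p s)) * p s"
    by (simp add: power2_eq_square algebra_simps)
  also have "\<dots> = - (b s * (q s * (p s)\<^sup>2) * p s)"
    unfolding P q unfolding p_square by (simp add: power2_eq_square algebra_simps)
  also have "\<dots> = - (b s * q s * p s) * (p s)\<^sup>2"
    by simp
  finally have cos_numerator: "a' * p s - a s * P = - (b s * q s * p s)"
    using p0 by (simp only: mult_cancel_right power_eq_0_iff) simp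
  have "(b' * p s - b s * P) * (p s)\<^sup>2 = (b' * (p s)\<^sup>2 - b s * (P * p s)) * p s"
    by (simp add: power2_eq_square algebra_simps)
  also have "\<dots> = a s * (q s * (p s)\<^sup>2) * p s"
    unfolding P q unfolding p_square by (simp add: power2_eq_square algebra_simps)
  also have "\<dots> = (a s * q s * p s) * (p s)\<^sup>2"
    by simp
  finally have sin_numerator: "b' * p s - b s * P = a s * q s * p s"
    using p0 by (simp only: mult_cancel_right power_eq_0_iff) simp
  show ?cos
    using DERIV_divide[OF da dp p0] p0 unfolding cos_numerator by (simp add: mult.commute)
  show ?sin
    using DERIV_divide[OF db dp p0] p0 unfolding sin_numerator by (simp add: mult.commute)
qed

text \<open>
  In \<open>Y'\<close> the terms from rotating the frame add up to \<open>\<theta>' D = q D\<close> and those from \<open>\<xi>\<^sub>1'\<close>, \<open>\<xi>\<^sub>3'\<close> to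
  \<open>- (a cos \<theta> + b sin \<theta>) \<xi>\<^sub>2 = - p \<xi>\<^sub>2\<close>; in \<open>D'\<close> the latter cancel because \<open>a sin \<theta> = b cos \<theta>\<close>.
\<close>

lemma alternative_frame_derivatives:
  defines "Y \<equiv> \<lambda>s. (b s / p s) *\<^sub>R B s - (a s / p s) *\<^sub>R \<xi> s"
    and "D \<equiv> \<lambda>s. (b s / p s) *\<^sub>R \<xi> s + (a s / p s) *\<^sub>R B s"
  assumes s: "s \<in> I"
  shows "(N has_vector_derivative p s *\<^sub>R Y s) (at s within I)"
    and "(Y has_vector_derivative q s *\<^sub>R D s - p s *\<^sub>R N s) (at s within I)"
    and "(D has_vector_derivative - q s *\<^sub>R Y s) (at s within I)"
proof -
  have p0: "p s \<noteq> 0"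
    using p_pos[OF s] by simp
  show "(N has_vector_derivative p s *\<^sub>R Y s) (at s within I)"
    using xi2_derivative[OF s] p0 by (simp add: Y_def scaleR_diff_right)
  note cs = cosine_sine_derivatives[OF s]
  note T = xi_derivative[OF s] and B = xi3_derivative[OF s]
  have "(b s / p s) * b s + (a s / p s) * a s = (p s)\<^sup>2 / p s"
    unfolding p_square by (simp add: power2_eq_square add_divide_distrib)
  then have pp: "(b s / p s) * b s + (a s / p s) * a s = p s"
    using p0 by (simp add: power2_eq_square)
  have "(Y has_vector_derivative
      ((b s / p s) *\<^sub>R (- b s *\<^sub>R N s) + (q s * (a s / p s)) *\<^sub>R B s)
      - ((a s / p s) *\<^sub>R (a s *\<^sub>R N s) + (- (q s * (b s / p s))) *\<^sub>R \<xi> s)) (at s within I)"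
    unfolding Y_def
    by (intro has_vector_derivative_diff has_vector_derivative_scaleR cs T B)
  also have "((b s / p s) *\<^sub>R (- b s *\<^sub>R N s) + (q s * (a s / p s)) *\<^sub>R B s)
      - ((a s / p s) *\<^sub>R (a s *\<^sub>R N s) + (- (q s * (b s / p s))) *\<^sub>R \<xi> s)
      = q s *\<^sub>R D s - ((b s / p s) * b s + (a s / p s) * a s) *\<^sub>R N s"
    by (simp add: D_def algebra_simps)
  finally show "(Y has_vector_derivative q s *\<^sub>R D s - p s *\<^sub>R N s) (at s within I)"
    unfolding pp .
  have "(D has_vector_derivative
      ((b s / p s) *\<^sub>R (a s *\<^sub>R N s) + (q s * (a s / p s)) *\<^sub>R \<xi> s)
      + ((a s / p s) *\<^sub>R (- b s *\<^sub>R N s) + (- (q s * (b s / p s))) *\<^sub>R B s)) (at s within I)"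
    unfolding D_def
    by (intro has_vector_derivative_add has_vector_derivative_scaleR cs T B)
  also have "((b s / p s) *\<^sub>R (a s *\<^sub>R N s) + (q s * (a s / p s)) *\<^sub>R \<xi> s)
      + ((a s / p s) *\<^sub>R (- b s *\<^sub>R N s) + (- (q s * (b s / p s))) *\<^sub>R B s) = - q s *\<^sub>R Y s"
    by (simp add: Y_def algebra_simps)
  finally show "(D has_vector_derivative - q s *\<^sub>R Y s) (at s within I)" .
qed

end

section \<open>The differential equation of the second frame vector\<close>

lemma interval_parameter_domain:
  assumes "is_interval I" "interior I \<noteq> {}"
  shows "parameter_domain I"
proof
  fix s assume s: "s \<in> I"
  have "connected I"
    using assms(1) by (simp add: is_interval_connected)
  moreover have "I \<noteq> {t}" for t
    using assms(2) by auto
  ultimately have "s islimpt I"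
    using s by (intro connected_imp_perfect) auto
  then show "at s within I \<noteq> bot"
    by (simp add: trivial_limit_within)
qed

theorem theorem13:
  fixes I :: "real set"
    and r \<xi> \<xi>\<^sub>2 Y D :: "real \<Rightarrow> real ^ 3"
    and \<pi> :: "real \<Rightarrow> (real ^ 3) set"
    and p q :: "real \<Rightarrow> real"
  assumes "is_interval I" and "interior I \<noteq> {}"
    and "myller_configuration I r \<xi> \<pi>"
    and "\<And>s. s \<in> I \<Longrightarrow> K1 I \<xi> s > 0"
    and "\<And>s. s \<in> I \<Longrightarrow> alternative_frame I \<xi> s = (\<xi>\<^sub>2 s, Y s, D s)"
    and "\<And>s. s \<in> I \<Longrightarrow> p s = alternative_p I \<xi> s"
    and "\<And>s. s \<in> I \<Longrightarrow> q s = alternative_q I \<xi> s"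
    and "\<And>s. s \<in> I \<Longrightarrow> p s \<noteq> 0"
    and "\<And>s. s \<in> I \<Longrightarrow> q s \<noteq> 0"
  shows "\<forall>s\<in>I.
    (deriv_on I ^^ 3) \<xi>\<^sub>2 s
    - (deriv_on I p s / p s + deriv_on I (\<lambda>t. p t * q t) s / (p s * q s))
        *\<^sub>R (deriv_on I ^^ 2) \<xi>\<^sub>2 s
    + (p s * q s * deriv_on I (\<lambda>t. deriv_on I (\<lambda>u. 1 / p u) t * (1 / q t)) s
         + (p s)\<^sup>2 + (q s)\<^sup>2) *\<^sub>R deriv_on I \<xi>\<^sub>2 s
    + (p s * q s * deriv_on I (\<lambda>t. p t / q t) s) *\<^sub>R \<xi>\<^sub>2 s = 0"
proof
  fix s assume s: "s \<in> I"
  interpret V: regular_versor_field I \<xi>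
    using interval_parameter_domain[OF assms(1,2)] assms(3,4)
    by (auto simp: regular_versor_field_def regular_versor_field_axioms_def
        myller_configuration_def)
  \<comment> \<open>The given frame agrees with the explicit one on \<open>I\<close> only, so the derivatives within \<open>I\<close> have to
    be transferred.\<close>
  have \<xi>\<^sub>2: "\<xi>\<^sub>2 t = V.N t"
    and Y: "Y t = (V.b t / V.p t) *\<^sub>R V.B t - (V.a t / V.p t) *\<^sub>R \<xi> t"
    and D: "D t = (V.b t / V.p t) *\<^sub>R \<xi> t + (V.a t / V.p t) *\<^sub>R V.B t" if "t \<in> I" for t
    using V.alternative_frame_eq[OF that] assms(5)[OF that] by simp_all
  show "(deriv_on I ^^ 3) \<xi>\<^sub>2 s
    - (deriv_on I p s / p s + deriv_on I (\<lambda>t. p t * q t) s / (p s * q s))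
        *\<^sub>R (deriv_on I ^^ 2) \<xi>\<^sub>2 s
    + (p s * q s * deriv_on I (\<lambda>t. deriv_on I (\<lambda>u. 1 / p u) t * (1 / q t)) s
         + (p s)\<^sup>2 + (q s)\<^sup>2) *\<^sub>R deriv_on I \<xi>\<^sub>2 s
    + (p s * q s * deriv_on I (\<lambda>t. p t / q t) s) *\<^sub>R \<xi>\<^sub>2 s = 0"
  proof (rule V.frenet_frame_ode[where N = \<xi>\<^sub>2 and Y = Y and D = D and p = p and q = q])
    show "(\<xi>\<^sub>2 has_vector_derivative p t *\<^sub>R Y t) (at t within I)" if "t \<in> I" for t
      using V.alternative_frame_derivatives(1)[OF that] Y[OF that] assms(6)[OF that]
      by (intro has_vector_derivative_transform[where f = V.N, OF that \<xi>\<^sub>2]) simp_all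
    show "(Y has_vector_derivative q t *\<^sub>R D t - p t *\<^sub>R \<xi>\<^sub>2 t) (at t within I)" if "t \<in> I" for t
      using V.alternative_frame_derivatives(2)[OF that] \<xi>\<^sub>2[OF that] D[OF that]
        assms(6,7)[OF that]
      by (intro has_vector_derivative_transform[
            where f = "\<lambda>t. (V.b t / V.p t) *\<^sub>R V.B t - (V.a t / V.p t) *\<^sub>R \<xi> t", OF that Y])
        simp_all
    show "(D has_vector_derivative - q t *\<^sub>R Y t) (at t within I)" if "t \<in> I" for t
      using V.alternative_frame_derivatives(3)[OF that] Y[OF that] assms(7)[OF that]
      by (intro has_vector_derivative_transform[
            where f = "\<lambda>t. (V.b t / V.p t) *\<^sub>R \<xi> t + (V.a t / V.p t) *\<^sub>R V.B t", OF that D])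
        simp_all
    show "smooth_along I p"
      by (rule V.smooth_cong[OF V.smooth_p assms(6)])
    show "smooth_along I q"
      by (rule V.smooth_cong[OF V.smooth_q assms(7)])
  qed (use assms(8,9) s in auto)
qed

end
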